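(* Let $1<q<p<\infty$, $\alpha\in\mathbb{R}$, let $v,w$ be weight functions on $\mathbb{R}$, and let $\phi\in L^1(\mathbb{R})$ be such that $$D_{\sup}:=\int_{\mathbb{R}} \frac{|\phi(t)|}{|t|^{2\alpha+2-\frac1q}}\left(\int_{\mathbb{R}}\frac{[v(ty)]^{\frac{p}{p-q}}}{[w(y)]^{\frac{q}{p-q}}}\,dy\right)^{\frac{p-q}{pq}}dt<\infty .$$ Then the operator $H_{\alpha,\phi}:L^p_w(\mathbb{R})\to L^q_v(\mathbb{R})$ is bounded and, for every $f\in L^p_w(\mathbb{R})$, $$\|H_{\alpha,\phi}f\|_{L^q_v(\mathbb{R})}\le D_{\sup}\,\|f\|_{L^p_w(\mathbb{R})}.$$
   Context: A weight function on $\mathbb{R}$ is a measurable function $v:\mathbb{R}\to[0,\infty]$ that is positive and finite almost everywhere. For $1\le r<\infty$, $L^r_v(\mathbb{R})$ is the weighted Lebesgue space with norm $\|f\|_{L^r_v(\mathbb{R})}=\left(\int_{\mathbb{R}}|f(x)|^r v(x)\,dx\right)^{1/r}$. The Dunkl-Hausdorff operator is $$H_{\alpha,\phi}f(x)=\int_{\mathbb{R}}\frac{|\phi(t)|}{|t|^{2\alpha+2}}f\left(\frac{x}{t}\right)dt .$$ It is bounded from $L^p_w(\mathbb{R})$ to $L^q_v(\mathbb{R})$ if for every $f\in L^p_w(\mathbb{R})$ the integral converges absolutely for a.e. $x$ and there is a finite constant $C$ with $\|H_{\alpha,\phi}f\|_{L^q_v(\mathbb{R})}\le C\|f\|_{L^p_w(\mathbb{R})}$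 for all such $f$. Convention: $0\cdot\infty=0$. *)

theory Defs
  imports "HOL-Analysis.Analysis"
begin

(* Measurability and integrals are with respect to Lebesgue measure, so functions need only be
   Lebesgue measurable. Functions are represented pointwise instead of as classes modulo
   equality almost everywhere. *)

definition weight_fun :: "(real \<Rightarrow> ennreal) \<Rightarrow> bool" where
  "weight_fun v \<longleftrightarrow>
     v \<in> borel_measurable lebesgue \<and> (AE x in lebesgue. 0 < v x \<and> v x < \<infinity>)"

(* Real powers on [0, infinity]. Meaningful for exponents r > 0 only, where 0^r = 0 and
   infinity^r = infinity; all uses below have a positive exponent. *)
definition epowr :: "ennreal \<Rightarrow> real \<Rightarrow> ennreal" where
  "epowr x r = (if x = \<infinity> then \<infinity> else ennreal (enn2real x powr r))"

(* Multiplication on ennreal satisfies 0 * infinity = 0. *)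
definition weighted_norm :: "real \<Rightarrow> (real \<Rightarrow> ennreal) \<Rightarrow> (real \<Rightarrow> complex) \<Rightarrow> ennreal" where
  "weighted_norm r v f =
     epowr (\<integral>\<^sup>+ x. ennreal (norm (f x) powr r) * v x \<partial>lebesgue) (1 / r)"

definition weighted_Lp :: "real \<Rightarrow> (real \<Rightarrow> ennreal) \<Rightarrow> (real \<Rightarrow> complex) set" where
  "weighted_Lp r v = {f. f \<in> borel_measurable lebesgue \<and> weighted_norm r v f < \<infinity>}"

(* At the single point t = 0 the value is 0, since x / 0 = 0 in HOL. *)
definition dunkl_integrand ::
    "real \<Rightarrow> (real \<Rightarrow> complex) \<Rightarrow> (real \<Rightarrow> complex) \<Rightarrow> real \<Rightarrow> real \<Rightarrow> complex" where
  "dunkl_integrand \<alpha> \<phi> f x t =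
     complex_of_real (norm (\<phi> t) / \<bar>t\<bar> powr (2 * \<alpha> + 2)) * f (x / t)"

(* The Bochner integral is 0 at those x where the integrand is not absolutely integrable;
   absolute convergence is demanded separately in dunkl_hausdorff_bounded. *)
definition dunkl_hausdorff ::
    "real \<Rightarrow> (real \<Rightarrow> complex) \<Rightarrow> (real \<Rightarrow> complex) \<Rightarrow> real \<Rightarrow> complex" where
  "dunkl_hausdorff \<alpha> \<phi> f x = (\<integral> t. dunkl_integrand \<alpha> \<phi> f x t \<partial>lebesgue)"

definition dunkl_hausdorff_bounded ::
    "real \<Rightarrow> (real \<Rightarrow> complex) \<Rightarrow> real \<Rightarrow> (real \<Rightarrow> ennreal) \<Rightarrow> real \<Rightarrow> (real \<Rightarrow> ennreal) \<Rightarrow> bool" where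
  "dunkl_hausdorff_bounded \<alpha> \<phi> p w q v \<longleftrightarrow>
     (\<forall>f\<in>weighted_Lp p w.
        (AE x in lebesgue. integrable lebesgue (dunkl_integrand \<alpha> \<phi> f x)) \<and>
        dunkl_hausdorff \<alpha> \<phi> f \<in> weighted_Lp q v) \<and>
     (\<exists>C::ennreal. C < \<infinity> \<and>
        (\<forall>f\<in>weighted_Lp p w.
           weighted_norm q v (dunkl_hausdorff \<alpha> \<phi> f) \<le> C * weighted_norm p w f))"

definition D_sup ::
    "real \<Rightarrow> (real \<Rightarrow> complex) \<Rightarrow> real \<Rightarrow> (real \<Rightarrow> ennreal) \<Rightarrow> real \<Rightarrow> (real \<Rightarrow> ennreal) \<Rightarrow> ennreal" where
  "D_sup \<alpha> \<phi> p w q v =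
     (\<integral>\<^sup>+ t. ennreal (norm (\<phi> t) / \<bar>t\<bar> powr (2 * \<alpha> + 2 - 1 / q)) *
        epowr (\<integral>\<^sup>+ y. epowr (v (t * y)) (p / (p - q)) / epowr (w y) (q / (p - q)) \<partial>lebesgue)
          ((p - q) / (p * q)) \<partial>lebesgue)"

end

theory Submission
  imports Defs
begin

text \<open>
  Write $k(t) = |\phi(t)| \, |t|^{-2\alpha-2}$, so that $|H f(x)|$ is at most
  $\int k(t) |f(x/t)| \, dt$. This is a superposition of dilates of $|f|$, and Minkowski's integral
  inequality (\<open>nn_integral_Minkowski\<close>) bounds its norm in $L^q_v$ by
  $\int k(t) \, \|f(\cdot/t)\|_{L^q_v} \, dt$.

  For one dilate, the substitution $x = ty$ gives
  $\|f(\cdot/t)\|_{L^q_v}^q = |t| \int |f(y)|^q v(ty) \, dy$. Splitting the integrand as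
  $(|f|^q w^{q/p}) \cdot (v(t\,\cdot) w^{-q/p})$ and applying Hoelder's inequality with the conjugate
  exponents $p/q$ and $p/(p-q)$ produces $\|f\|_{L^p_w}^q$ times exactly the inner integral of
  $D_{\sup}$ to the power $(p-q)/p$ (\<open>weighted_norm_dilation_le\<close>). Taking $q$-th roots and
  integrating against $k$ yields the constant $D_{\sup}$. Since the estimate is for the integral of
  the absolute value and $v > 0$ almost everywhere, its finiteness also gives absolute convergence at
  almost every $x$.

  Tonelli's theorem needs joint measurability of $(x,t) \mapsto f(x/t)$, which a merely Lebesgue
  measurable $f$ need not have with respect to the product of the Lebesgue $\sigma$-algebras. The
  estimates are therefore proved for Borel functions first. Passing to Borel representatives changes
  nothing, because $y \mapsto ty$ and $t \mapsto x/t$ pull null sets back to null sets for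
  $t \neq 0$ and $x \neq 0$.
\<close>

section \<open>Real powers of extended nonnegative numbers\<close>

lemma epowr_top [simp]: "epowr top r = top"
  by (simp add: epowr_def)

lemma epowr_ennreal: "0 \<le> a \<Longrightarrow> epowr (ennreal a) r = ennreal (a powr r)"
  by (simp add: epowr_def)

lemma epowr_0 [simp]: "epowr 0 r = 0"
  by (simp add: epowr_def)

lemma epowr_one [simp]: "epowr 1 r = 1"
  by (simp add: epowr_def)

lemma epowr_exponent_one [simp]: "epowr x 1 = x"
  by (cases x) (auto simp: epowr_ennreal)

lemma epowr_eq_0_iff [simp]: "epowr x r = 0 \<longleftrightarrow> x = 0"
  by (cases x) (auto simp: epowr_ennreal)

lemma epowr_eq_top_iff [simp]: "epowr x r = top \<longleftrightarrow> x = top"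
  by (cases x) (auto simp: epowr_ennreal)

lemma epowr_less_top_iff [simp]: "epowr x r < top \<longleftrightarrow> x < top"
  by (simp flip: less_top add: less_top[symmetric])

lemma epowr_mult:
  assumes "0 < r"
  shows "epowr (x * y) r = epowr x r * epowr y r"
proof (cases "x = \<infinity> \<or> y = \<infinity>")
  case True
  then show ?thesis
    by (cases "x = 0 \<or> y = 0") (auto simp: ennreal_mult_top ennreal_top_mult)
next
  case False
  then show ?thesis
    by (cases x; cases y) (auto simp: epowr_ennreal powr_mult simp flip: ennreal_mult)
qed

lemma epowr_epowr: "epowr (epowr x r) s = epowr x (r * s)"
  by (cases x) (auto simp: epowr_ennreal powr_powr)

lemma epowr_add:
  "epowr x r * epowr x s = epowr x (r + s)"
  by (cases x) (auto simp: epowr_ennreal powr_add ennreal_mult ennreal_top_mult)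

lemma epowr_mono:
  assumes "0 < r" and "x \<le> y"
  shows "epowr x r \<le> epowr y r"
proof (cases "y = \<infinity>")
  case False
  then show ?thesis
    using assms by (cases x; cases y) (auto simp: epowr_ennreal powr_mono2 top_unique)
qed simp

lemma borel_measurable_epowr [measurable (raw)]:
  assumes [measurable]: "f \<in> borel_measurable M"
  shows "(\<lambda>x. epowr (f x) r) \<in> borel_measurable M"
  unfolding epowr_def by measurable

section \<open>The integral inequalities of Hoelder and Minkowski\<close>

lemma ennreal_Youngs_inequality:
  fixes x y :: ennreal
  assumes "1 < a" and "1 < b" and "1 / a + 1 / b = 1"
  shows "x * y \<le> ennreal (1 / a) * epowr x a + ennreal (1 / b) * epowr y b"
proof (cases "x = \<infinity> \<or> y = \<infinity>")
  case True
  then show ?thesis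
    using assms by (auto simp: ennreal_mult_top)
next
  case False
  then obtain u v where "x = ennreal u" "0 \<le> u" "y = ennreal v" "0 \<le> v"
    by (cases x; cases y) auto
  then show ?thesis
    using Youngs_inequality[OF assms, of u v] assms
    by (simp add: epowr_ennreal flip: ennreal_mult ennreal_plus)
qed

text \<open>
  After dividing both functions by their norms, Young's inequality holds pointwise and integrates
  to $1/a + 1/b = 1$. The division needs both norms positive and finite; a vanishing norm makes the
  product vanish almost everywhere, and otherwise an infinite norm makes the right-hand side infinite.
\<close>

theorem nn_integral_Hoelder:
  fixes f g :: "'a \<Rightarrow> ennreal"
  assumes ab: "1 < a" "1 < b" "1 / a + 1 / b = 1"
    and [measurable]: "f \<in> borel_measurable M" "g \<in> borel_measurable M"
  shows "(\<integral>\<^sup>+x. f x * g x \<partial>M)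
    \<le> epowr (\<integral>\<^sup>+x. epowr (f x) a \<partial>M) (1 / a) * epowr (\<integral>\<^sup>+x. epowr (g x) b \<partial>M) (1 / b)"
proof -
  define A where "A = epowr (\<integral>\<^sup>+x. epowr (f x) a \<partial>M) (1 / a)"
  define B where "B = epowr (\<integral>\<^sup>+x. epowr (g x) b \<partial>M) (1 / b)"
  have A_pow: "epowr A a = (\<integral>\<^sup>+x. epowr (f x) a \<partial>M)" and B_pow: "epowr B b = (\<integral>\<^sup>+x. epowr (g x) b \<partial>M)"
    using ab by (simp_all add: A_def B_def epowr_epowr)
  show ?thesis
  proof (cases "A = 0 \<or> B = 0")
    case True
    then have "(AE x in M. f x = 0) \<or> (AE x in M. g x = 0)"
      by (auto simp: A_def B_def nn_integral_0_iff_AE)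
    then have "AE x in M. f x * g x = 0"
      by auto
    then have "(\<integral>\<^sup>+x. f x * g x \<partial>M) = 0"
      by (subst nn_integral_0_iff_AE) auto
    then show ?thesis
      by simp
  next
    case nonzero: False
    show ?thesis
    proof (cases "A = \<infinity> \<or> B = \<infinity>")
      case True
      then show ?thesis
        using nonzero unfolding A_def[symmetric] B_def[symmetric]
        by (auto simp: ennreal_mult_top ennreal_top_mult)
    next
      case False
      then have inv: "A * inverse A = 1" "B * inverse B = 1"
        using nonzero by (auto intro!: ennreal_divide_self simp: less_top simp flip: divide_ennreal_def)
      have unit_f: "(\<integral>\<^sup>+x. epowr (f x * inverse A) a \<partial>M) = 1"
        using ab inv by (simp add: epowr_mult nn_integral_multc flip: A_pow) (simp flip: epowr_mult)
      have unit_g: "(\<integral>\<^sup>+x. epowr (g x * inverse B) b \<partial>M) = 1"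
        using ab inv by (simp add: epowr_mult nn_integral_multc flip: B_pow) (simp flip: epowr_mult)
      have split: "f x * g x = A * B * ((f x * inverse A) * (g x * inverse B))" for x
      proof -
        have "A * B * ((f x * inverse A) * (g x * inverse B))
          = (A * inverse A) * (B * inverse B) * (f x * g x)"
          by (simp add: mult_ac)
        then show ?thesis
          using inv by simp
      qed
      have "(\<integral>\<^sup>+x. f x * g x \<partial>M) = A * B * (\<integral>\<^sup>+x. (f x * inverse A) * (g x * inverse B) \<partial>M)"
        by (subst split) (rule nn_integral_cmult, measurable)
      also have "\<dots> \<le> A * B * (\<integral>\<^sup>+x. ennreal (1 / a) * epowr (f x * inverse A) a
          + ennreal (1 / b) * epowr (g x * inverse B) b \<partial>M)"
        by (intro mult_left_mono nn_integral_mono ennreal_Youngs_inequality ab) simp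
      also have "(\<integral>\<^sup>+x. ennreal (1 / a) * epowr (f x * inverse A) a
          + ennreal (1 / b) * epowr (g x * inverse B) b \<partial>M) = 1"
        using ab by (simp add: nn_integral_add nn_integral_cmult unit_f unit_g flip: ennreal_plus)
      finally show ?thesis
        by (simp add: A_def B_def)
    qed
  qed
qed

text \<open>
  Let $B(t)$ be the $L^q$ norm of $F(\cdot,t)$ and $S = \int B$. For fixed $x$, Hoelder's inequality
  applied to $F = B^{1/q'} \cdot (F B^{-1/q'})$ gives
  $(\int F \, dt)^q \le S^{q-1} \int F^q B^{-(q-1)} \, dt$. Integrating in $x$ with Tonelli's theorem
  turns the right-hand side into $S^{q-1} \int B^q B^{-(q-1)} \, dt = S^q$. In contrast to the proof that
  splits off a factor $(\int F \, dt)^{q-1}$, nothing has to be cancelled at the end, so the left-hand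
  side may be infinite a priori.
\<close>

theorem (in pair_sigma_finite) nn_integral_Minkowski:
  fixes F :: "'a \<Rightarrow> 'b \<Rightarrow> ennreal"
  assumes q: "1 < q"
    and F [measurable]: "case_prod F \<in> borel_measurable (M1 \<Otimes>\<^sub>M M2)"
  shows "epowr (\<integral>\<^sup>+x. epowr (\<integral>\<^sup>+t. F x t \<partial>M2) q \<partial>M1) (1 / q)
    \<le> (\<integral>\<^sup>+t. epowr (\<integral>\<^sup>+x. epowr (F x t) q \<partial>M1) (1 / q) \<partial>M2)"
proof -
  define q' where "q' = q / (q - 1)"
  have q': "1 < q'" "1 / q' + 1 / q = 1" "1 / q' * q' = 1" "1 / q' * q = q - 1"
    using q by (auto simp: q'_def field_simps)
  define B where "B t = epowr (\<integral>\<^sup>+x. epowr (F x t) q \<partial>M1) (1 / q)" for t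
  have B_meas [measurable]: "B \<in> borel_measurable M2"
    unfolding B_def by measurable
  have B_pow: "epowr (B t) q = (\<integral>\<^sup>+x. epowr (F x t) q \<partial>M1)" for t
    using q by (simp add: B_def epowr_epowr)
  define S where "S = (\<integral>\<^sup>+t. B t \<partial>M2)"
  \<comment> \<open>This is $B^{-1/q'}$, set to 0 where $B$ is 0 or infinite. The latter is a null set once $S$ is
    finite; the set where $B$ vanishes may have positive measure, but there
    $F(\cdot,t) = 0$ almost everywhere, so the factorization below survives.\<close>
  define c where "c t = (if B t = 0 \<or> B t = \<infinity> then 0 else inverse (epowr (B t) (1 / q')))" for t
  have c_meas [measurable]: "c \<in> borel_measurable M2"
    unfolding c_def by measurable
  have c_B: "epowr (c t) q * epowr (B t) q \<le> B t" for t
  proof (cases "B t = 0 \<or> B t = \<infinity>")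
    case False
    then obtain \<beta> where "B t = ennreal \<beta>" "0 < \<beta>"
      by (cases "B t") (auto simp: less_le)
    then show ?thesis
      using q q' 
      by (simp add: c_def epowr_ennreal inverse_ennreal powr_powr
          flip: powr_minus epowr_mult powr_add)
        (simp add: epowr_ennreal algebra_simps flip: powr_add ennreal_mult)
  qed (use q in \<open>auto simp: c_def\<close>)
  show ?thesis
  proof (cases "S = \<infinity>")
    case True
    then show ?thesis
      by (simp add: S_def B_def)
  next
    case S_fin: False
    have "AE t in M2. AE x in M1. (B t \<noteq> 0 \<and> B t \<noteq> \<infinity>) \<or> F x t = 0"
    proof -
      have zero: "AE x in M1. F x t = 0" if "B t = 0" "t \<in> space M2" for t
      proof -
        have "(\<integral>\<^sup>+x. epowr (F x t) q \<partial>M1) = 0"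
          using that by (simp flip: B_pow)
        then show ?thesis
          using that by (subst (asm) nn_integral_0_iff_AE) auto
      qed
      have "AE t in M2. B t \<noteq> \<infinity>"
        using S_fin unfolding S_def by (intro nn_integral_noteq_infinite) auto
      moreover have "AE t in M2. t \<in> space M2"
        by (rule AE_space)
      ultimately show ?thesis
      proof eventually_elim
        case (elim t)
        then show ?case
          using zero[of t] by (cases "B t = 0") auto
      qed
    qed
    moreover have "{z \<in> space (M1 \<Otimes>\<^sub>M M2). (B (snd z) \<noteq> 0 \<and> B (snd z) \<noteq> \<infinity>) \<or> F (fst z) (snd z) = 0}
      \<in> sets (M1 \<Otimes>\<^sub>M M2)"
    proof -
      have [measurable]: "(\<lambda>z. F (fst z) (snd z)) \<in> borel_measurable (M1 \<Otimes>\<^sub>M M2)"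
        using F by (simp add: case_prod_beta')
      show ?thesis
        by measurable
    qed
    ultimately have "AE x in M1. AE t in M2. (B t \<noteq> 0 \<and> B t \<noteq> \<infinity>) \<or> F x t = 0"
      using AE_commute[of "\<lambda>x t. (B t \<noteq> 0 \<and> B t \<noteq> \<infinity>) \<or> F x t = 0"] by blast
    then have "AE x in M1. epowr (\<integral>\<^sup>+t. F x t \<partial>M2) q
      \<le> epowr S (q - 1) * (\<integral>\<^sup>+t. epowr (F x t * c t) q \<partial>M2)"
      using AE_space
    proof eventually_elim
      case (elim x)
      note [measurable] = elim(2)
      have "(\<integral>\<^sup>+t. F x t \<partial>M2) \<le> (\<integral>\<^sup>+t. epowr (B t) (1 / q') * (F x t * c t) \<partial>M2)"
      proof (rule nn_integral_mono_AE, use elim(1) in eventually_elim)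
        fix t assume t: "(B t \<noteq> 0 \<and> B t \<noteq> \<infinity>) \<or> F x t = 0"
        show "F x t \<le> epowr (B t) (1 / q') * (F x t * c t)"
        proof (cases "F x t = 0")
          case False
          then have "epowr (B t) (1 / q') * c t = 1"
            using t by (auto simp: c_def less_top intro!: ennreal_divide_self simp flip: divide_ennreal_def)
          then have "F x t = F x t * (epowr (B t) (1 / q') * c t)"
            by simp
          then show ?thesis
            by (simp add: mult_ac)
        qed simp
      qed
      also have "\<dots> \<le> epowr (\<integral>\<^sup>+t. epowr (epowr (B t) (1 / q')) q' \<partial>M2) (1 / q')
          * epowr (\<integral>\<^sup>+t. epowr (F x t * c t) q \<partial>M2) (1 / q)"
        using q q' by (intro nn_integral_Hoelder) (auto simp: add.commute)
      also have "(\<integral>\<^sup>+t. epowr (epowr (B t) (1 / q')) q' \<partial>M2) = S"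
        using q' by (simp only: S_def epowr_epowr epowr_exponent_one)
      finally have "epowr (\<integral>\<^sup>+t. F x t \<partial>M2) q
        \<le> epowr (epowr S (1 / q') * epowr (\<integral>\<^sup>+t. epowr (F x t * c t) q \<partial>M2) (1 / q)) q"
        using q by (intro epowr_mono) auto
      then show ?case
        using q q' by (simp add: epowr_mult epowr_epowr)
    qed
    then have "(\<integral>\<^sup>+x. epowr (\<integral>\<^sup>+t. F x t \<partial>M2) q \<partial>M1)
      \<le> (\<integral>\<^sup>+x. epowr S (q - 1) * (\<integral>\<^sup>+t. epowr (F x t * c t) q \<partial>M2) \<partial>M1)"
      by (rule nn_integral_mono_AE)
    also have "\<dots> = epowr S (q - 1) * (\<integral>\<^sup>+x. (\<integral>\<^sup>+t. epowr (F x t * c t) q \<partial>M2) \<partial>M1)"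
      by (intro nn_integral_cmult) measurable
    also have "(\<integral>\<^sup>+x. (\<integral>\<^sup>+t. epowr (F x t * c t) q \<partial>M2) \<partial>M1)
      = (\<integral>\<^sup>+t. (\<integral>\<^sup>+x. epowr (F x t * c t) q \<partial>M1) \<partial>M2)"
      by (rule Fubini'[symmetric]) measurable
    also have "\<dots> = (\<integral>\<^sup>+t. epowr (c t) q * epowr (B t) q \<partial>M2)"
    proof (rule nn_integral_cong)
      fix t assume [measurable]: "t \<in> space M2"
      have "(\<integral>\<^sup>+x. epowr (F x t * c t) q \<partial>M1) = (\<integral>\<^sup>+x. epowr (c t) q * epowr (F x t) q \<partial>M1)"
        using q by (simp add: epowr_mult mult.commute)
      also have "\<dots> = epowr (c t) q * epowr (B t) q"
        unfolding B_pow by (rule nn_integral_cmult) measurable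
      finally show "(\<integral>\<^sup>+x. epowr (F x t * c t) q \<partial>M1) = epowr (c t) q * epowr (B t) q" .
    qed
    also have "\<dots> \<le> S"
      unfolding S_def by (intro nn_integral_mono c_B)
    finally have "(\<integral>\<^sup>+x. epowr (\<integral>\<^sup>+t. F x t \<partial>M2) q \<partial>M1) \<le> epowr S (q - 1) * epowr S 1"
      by (simp add: mult_left_mono)
    then have "epowr (\<integral>\<^sup>+x. epowr (\<integral>\<^sup>+t. F x t \<partial>M2) q \<partial>M1) (1 / q) \<le> epowr (epowr S q) (1 / q)"
      unfolding epowr_add using q by (intro epowr_mono) auto
    then show ?thesis
      using q by (simp add: epowr_epowr S_def B_def)
  qed
qed

section \<open>Null sets and Borel representatives\<close>

text \<open>
  Up to the null set where $g$ fails to invert $h$, the exceptional set of the composition lies in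
  the image of the given null set under $g$, and differentiable maps send null sets to null sets.
\<close>

lemma AE_lebesgue_comp:
  fixes h :: "real \<Rightarrow> real"
  assumes P: "AE y in lebesgue. P y" and g: "g differentiable_on S"
    and inv: "AE x in lebesgue. h x \<in> S \<and> g (h x) = x"
  shows "AE x in lebesgue. P (h x)"
proof -
  have "{y. \<not> P y} \<in> null_sets lebesgue"
    using P by (simp add: completion.AE_iff_null_sets)
  then have "negligible ({y. \<not> P y} \<inter> S)"
    by (simp add: negligible_iff_null_sets[symmetric] negligible_Int)
  then have "negligible (g ` ({y. \<not> P y} \<inter> S))"
    using g by (intro negligible_differentiable_image_negligible) (auto intro: differentiable_on_subset)
  then have "AE x in lebesgue. x \<notin> g ` ({y. \<not> P y} \<inter> S)"
    by (intro AE_not_in) (simp add: negligible_iff_null_sets)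
  then show ?thesis
    using inv by eventually_elim force
qed

lemma AE_lebesgue_neq: "AE x in lebesgue. x \<noteq> (c :: real)"
  by (rule AE_completion, rule AE_lborel_singleton)

lemma AE_lebesgue_dilate:
  fixes t :: real
  assumes "AE y in lebesgue. P y" and "t \<noteq> 0"
  shows "AE x in lebesgue. P (t * x)"
  using assms(1)
proof (rule AE_lebesgue_comp)
  show "(\<lambda>y. y / t) differentiable_on UNIV"
    using assms(2)
    by (auto simp: differentiable_on_def simp: real_differentiable_def intro!: exI derivative_eq_intros)
qed (use assms(2) in auto)

lemma AE_lebesgue_divide_left:
  fixes x :: real
  assumes "AE y in lebesgue. P y" and "x \<noteq> 0"
  shows "AE t in lebesgue. P (x / t)"
  using assms(1)
proof (rule AE_lebesgue_comp)
  show "(\<lambda>y. x / y) differentiable_on (- {0})"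
    by (auto simp: differentiable_on_def simp: real_differentiable_def intro!: exI derivative_eq_intros)
  show "AE t in lebesgue. x / t \<in> - {0} \<and> x / (x / t) = t"
    using AE_lebesgue_neq[of 0] by eventually_elim (use assms(2) in auto)
qed

lemma lebesgue_complex_Borel_representative:
  fixes f :: "real \<Rightarrow> complex"
  assumes [measurable]: "f \<in> borel_measurable lebesgue"
  obtains g where "g \<in> borel_measurable borel" "AE x in lebesgue. f x = g x"
proof -
  have "(\<lambda>x. Re (f x)) \<in> borel_measurable lebesgue" "(\<lambda>x. Im (f x)) \<in> borel_measurable lebesgue"
    by measurable
  then obtain a b where [measurable]: "a \<in> borel_measurable borel" "b \<in> borel_measurable borel"
    and ab: "AE x in lborel. Re (f x) = a x" "AE x in lborel. Im (f x) = b x"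
    using completion_ex_borel_measurable_real[of "\<lambda>x. Re (f x)" lborel]
      completion_ex_borel_measurable_real[of "\<lambda>x. Im (f x)" lborel] by auto
  show thesis
  proof
    have "(\<lambda>x. complex_of_real (a x) + \<i> * complex_of_real (b x)) \<in> borel_measurable borel"
      by measurable
    then show "(\<lambda>x. Complex (a x) (b x)) \<in> borel_measurable borel"
      by (simp add: Complex_eq)
    have "AE x in lborel. f x = Complex (a x) (b x)"
      using ab by eventually_elim (simp add: complex_eq_iff)
    then show "AE x in lebesgue. f x = Complex (a x) (b x)"
      by (rule AE_completion)
  qed
qed

lemma weight_fun_Borel_representative:
  assumes "weight_fun v"
  obtains v' where "v' \<in> borel_measurable borel" "weight_fun v'" "AE x in lebesgue. v x = v' x"
proof -
  have v: "v \<in> borel_measurable lebesgue" "AE x in lebesgue. 0 < v x \<and> v x < \<infinity>"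
    using assms by (auto simp: weight_fun_def)
  then obtain v' where v': "v' \<in> borel_measurable borel" and "AE x in lborel. v x = v' x"
    using completion_ex_borel_measurable[of v lborel] by auto
  then have eq: "AE x in lebesgue. v x = v' x"
    by (simp add: AE_completion)
  have "AE x in lebesgue. 0 < v' x \<and> v' x < \<infinity>"
    using eq v(2) by eventually_elim simp
  with v' eq show thesis
    by (intro that[of v']) (auto simp: weight_fun_def intro: measurable_completion)
qed

lemma weighted_norm_cong_AE:
  assumes "AE x in lebesgue. v x = v' x" "AE x in lebesgue. f x = f' x"
  shows "weighted_norm r v f = weighted_norm r v' f'"
proof -
  have "AE x in lebesgue. ennreal (norm (f x) powr r) * v x = ennreal (norm (f' x) powr r) * v' x"
    using assms by eventually_elim simp
  then show ?thesis
    unfolding weighted_norm_def by (simp cong: nn_integral_cong_AE)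
qed

lemma D_sup_cong_AE:
  assumes \<phi>: "AE t in lebesgue. \<phi> t = \<phi>' t" and v: "AE x in lebesgue. v x = v' x"
    and w: "AE x in lebesgue. w x = w' x"
  shows "D_sup \<alpha> \<phi> p w q v = D_sup \<alpha> \<phi>' p w' q v'"
proof -
  have inner: "(\<integral>\<^sup>+ y. epowr (v (t * y)) a / epowr (w y) b \<partial>lebesgue)
      = (\<integral>\<^sup>+ y. epowr (v' (t * y)) a / epowr (w' y) b \<partial>lebesgue)" if "t \<noteq> 0" for t a b
  proof (rule nn_integral_cong_AE)
    show "AE y in lebesgue. epowr (v (t * y)) a / epowr (w y) b = epowr (v' (t * y)) a / epowr (w' y) b"
      using AE_lebesgue_dilate[OF v that] w by eventually_elim simp
  qed
  show ?thesis
    unfolding D_sup_def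
  proof (rule nn_integral_cong_AE)
    show "AE t in lebesgue.
       ennreal (norm (\<phi> t) / \<bar>t\<bar> powr (2 * \<alpha> + 2 - 1 / q)) *
        epowr (\<integral>\<^sup>+ y. epowr (v (t * y)) (p / (p - q)) / epowr (w y) (q / (p - q)) \<partial>lebesgue)
          ((p - q) / (p * q))
     = ennreal (norm (\<phi>' t) / \<bar>t\<bar> powr (2 * \<alpha> + 2 - 1 / q)) *
        epowr (\<integral>\<^sup>+ y. epowr (v' (t * y)) (p / (p - q)) / epowr (w' y) (q / (p - q)) \<partial>lebesgue)
          ((p - q) / (p * q))"
      using \<phi> AE_lebesgue_neq[of 0] by eventually_elim (simp add: inner)
  qed
qed

text \<open>
  The exceptional null set of $t$ depends on $x$, yet every $x \neq 0$ is admissible. Hence changing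
  $f$ on a null set changes neither the convergence nor the value of $H f(x)$ at any $x \neq 0$.
\<close>

lemma dunkl_integrand_cong_AE:
  assumes \<phi>: "AE t in lebesgue. \<phi> t = \<phi>' t" and f: "AE y in lebesgue. f y = f' y" and x: "x \<noteq> 0"
  shows "AE t in lebesgue. dunkl_integrand \<alpha> \<phi> f x t = dunkl_integrand \<alpha> \<phi>' f' x t"
  using \<phi> AE_lebesgue_divide_left[OF f x] by eventually_elim (simp add: dunkl_integrand_def)

section \<open>Norm estimates for the Dunkl-Hausdorff operator\<close>

text \<open>
  The exponents are dictated by the target: multiplying and dividing by $w^{q/p}$ completes $|f|^q$ to
  a function whose $p/q$-th power is $|f|^p w$, and the conjugate exponent $p/(p-q)$ turns the
  remaining factor $v(ty) w^{-q/p}$ into the integrand of $D_{\sup}$. The factor $|t|^{1/q}$ is the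
  Jacobian of the dilation.
\<close>

lemma weighted_norm_dilation_le:
  fixes f :: "real \<Rightarrow> complex"
  assumes pq: "1 < q" "q < p" and t: "t \<noteq> 0"
    and [measurable]: "f \<in> borel_measurable borel" "v \<in> borel_measurable borel" "w \<in> borel_measurable borel"
    and w: "weight_fun w"
  shows "weighted_norm q v (\<lambda>x. f (x / t)) \<le> ennreal (\<bar>t\<bar> powr (1 / q)) *
     epowr (\<integral>\<^sup>+ y. epowr (v (t * y)) (p / (p - q)) / epowr (w y) (q / (p - q)) \<partial>lebesgue)
        ((p - q) / (p * q)) * weighted_norm p w f"
proof -
  define W where "W = (\<integral>\<^sup>+ y. epowr (v (t * y)) (p / (p - q)) / epowr (w y) (q / (p - q)) \<partial>lborel)"
  define I where "I = (\<integral>\<^sup>+ y. epowr (ennreal (norm (f y))) p * w y \<partial>lborel)"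
  \<comment> \<open>The identity $w^{q/p} r = 1$ fails where $w$ is 0 or infinite, hence the restriction to
    almost every $y$ below.\<close>
  define r where "r y = inverse (epowr (w y) (q / p))" for y
  have r_meas [measurable]: "r \<in> borel_measurable borel"
    unfolding r_def by measurable
  have w': "AE y in lborel. 0 < w y \<and> w y < \<infinity>"
    using w by (simp add: weight_fun_def AE_completion_iff)
  have w_r: "epowr (w y) (q / p) * r y = 1" if "0 < w y \<and> w y < \<infinity>" for y
    unfolding r_def divide_ennreal_def[symmetric] using that
    by (intro ennreal_divide_self) (auto simp: less_top)
  have r_pow: "epowr (r y) (p / (p - q)) = inverse (epowr (w y) (q / (p - q)))" if "0 < w y \<and> w y < \<infinity>" for y
  proof -
    have "w y = ennreal (enn2real (w y))" "0 < enn2real (w y)"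
      using that by (auto simp: enn2real_positive_iff less_top)
    then obtain u where "w y = ennreal u" "0 < u"
      by blast
    then show ?thesis
      using pq by (simp add: r_def epowr_ennreal inverse_ennreal powr_powr flip: powr_minus)
  qed
  have pos: "0 < p / q" "0 < 1 / q"
    using pq by auto
  have exponents: "q * (p / q) = p" "q / p * (p / q) = 1" "1 / (p / q) = q / p"
      "1 / (p / (p - q)) = (p - q) / p" "q / p * (1 / q) = 1 / p" "(p - q) / p * (1 / q) = (p - q) / (p * q)"
    using pq by (auto simp: field_simps)
  have substitution: "(\<integral>\<^sup>+x. epowr (ennreal (norm (f (x / t)))) q * v x \<partial>lborel)
    = ennreal \<bar>t\<bar> * (\<integral>\<^sup>+y. epowr (ennreal (norm (f y))) q * v (t * y) \<partial>lborel)"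
    using t by (subst nn_integral_real_affine[where c = t and t = 0]) auto
  have "(\<integral>\<^sup>+y. epowr (ennreal (norm (f y))) q * v (t * y) \<partial>lborel)
    = (\<integral>\<^sup>+y. (epowr (ennreal (norm (f y))) q * epowr (w y) (q / p)) * (r y * v (t * y)) \<partial>lborel)"
  proof (rule nn_integral_cong_AE, use w' in eventually_elim)
    fix y assume "0 < w y \<and> w y < \<infinity>"
    then have "epowr (ennreal (norm (f y))) q * v (t * y)
      = (epowr (w y) (q / p) * r y) * (epowr (ennreal (norm (f y))) q * v (t * y))"
      using w_r by simp
    also have "\<dots> = (epowr (ennreal (norm (f y))) q * epowr (w y) (q / p)) * (r y * v (t * y))"
      by (simp only: mult_ac)
    finally show "epowr (ennreal (norm (f y))) q * v (t * y)
      = (epowr (ennreal (norm (f y))) q * epowr (w y) (q / p)) * (r y * v (t * y))" .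
  qed
  also have "\<dots> \<le> epowr (\<integral>\<^sup>+y. epowr (epowr (ennreal (norm (f y))) q * epowr (w y) (q / p)) (p / q) \<partial>lborel)
        (1 / (p / q))
      * epowr (\<integral>\<^sup>+y. epowr (r y * v (t * y)) (p / (p - q)) \<partial>lborel) (1 / (p / (p - q)))"
    using pq by (intro nn_integral_Hoelder) (auto simp: field_simps)
  also have "(\<integral>\<^sup>+y. epowr (epowr (ennreal (norm (f y))) q * epowr (w y) (q / p)) (p / q) \<partial>lborel) = I"
    by (simp only: I_def epowr_mult[OF pos(1)] epowr_epowr exponents epowr_exponent_one)
  also have "(\<integral>\<^sup>+y. epowr (r y * v (t * y)) (p / (p - q)) \<partial>lborel) = W"
    unfolding W_def
  proof (rule nn_integral_cong_AE, use w' in eventually_elim)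
    fix y assume "0 < w y \<and> w y < \<infinity>"
    then show "epowr (r y * v (t * y)) (p / (p - q)) = epowr (v (t * y)) (p / (p - q)) / epowr (w y) (q / (p - q))"
      using pq r_pow by (simp add: epowr_mult divide_ennreal_def mult.commute)
  qed
  finally have "(\<integral>\<^sup>+y. epowr (ennreal (norm (f y))) q * v (t * y) \<partial>lborel)
    \<le> epowr I (q / p) * epowr W ((p - q) / p)"
    unfolding exponents .
  then have "epowr (\<integral>\<^sup>+x. epowr (ennreal (norm (f (x / t)))) q * v x \<partial>lborel) (1 / q)
    \<le> epowr (ennreal \<bar>t\<bar> * (epowr I (q / p) * epowr W ((p - q) / p))) (1 / q)"
    unfolding substitution using pos by (intro epowr_mono mult_left_mono) auto
  also have "\<dots> = ennreal (\<bar>t\<bar> powr (1 / q)) * epowr W ((p - q) / (p * q)) * epowr I (1 / p)"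
    by (simp only: epowr_mult[OF pos(2)] epowr_epowr exponents epowr_ennreal[OF abs_ge_zero])
      (simp add: mult_ac)
  finally show ?thesis
    by (simp add: weighted_norm_def W_def I_def nn_integral_completion epowr_ennreal)
qed

text \<open>
  Minkowski's inequality is stated without a weight. The weight is absorbed by applying it to
  $F(x,t) \, v(x)^{1/q}$, which keeps both measures equal to the $\sigma$-finite Lebesgue measure even
  where $v$ is infinite.
\<close>

lemma weighted_norm_absolute_dunkl_hausdorff_le:
  fixes f \<phi> :: "real \<Rightarrow> complex"
  assumes pq: "1 < q" "q < p"
    and [measurable]: "f \<in> borel_measurable borel" "\<phi> \<in> borel_measurable borel"
      "v \<in> borel_measurable borel" "w \<in> borel_measurable borel"
    and w: "weight_fun w"
  shows "epowr (\<integral>\<^sup>+x. epowr (\<integral>\<^sup>+t. ennreal (norm (dunkl_integrand \<alpha> \<phi> f x t)) \<partial>lborel) q * v x \<partial>lborel) (1 / q)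
     \<le> D_sup \<alpha> \<phi> p w q v * weighted_norm p w f"
proof -
  define k where "k t = norm (\<phi> t) / \<bar>t\<bar> powr (2 * \<alpha> + 2)" for t
  have k0: "0 \<le> k t" for t
    by (simp add: k_def)
  have k_meas [measurable]: "k \<in> borel_measurable borel"
    unfolding k_def by measurable
  define F where "F x t = ennreal (k t) * ennreal (norm (f (x / t)))" for x t
  have F_meas [measurable]: "case_prod F \<in> borel_measurable (lborel \<Otimes>\<^sub>M lborel)"
    unfolding F_def by measurable
  have F_eq: "ennreal (norm (dunkl_integrand \<alpha> \<phi> f x t)) = F x t" for x t
    by (simp add: dunkl_integrand_def F_def norm_mult norm_divide k_def flip: ennreal_mult)
  define K where "K t = epowr (\<integral>\<^sup>+ y. epowr (v (t * y)) (p / (p - q)) / epowr (w y) (q / (p - q)) \<partial>lborel)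
        ((p - q) / (p * q))" for t
  have K_meas [measurable]: "K \<in> borel_measurable borel"
    unfolding K_def by measurable
  have "(\<integral>\<^sup>+x. epowr (\<integral>\<^sup>+t. F x t \<partial>lborel) q * v x \<partial>lborel)
    = (\<integral>\<^sup>+x. epowr (\<integral>\<^sup>+t. F x t * epowr (v x) (1 / q) \<partial>lborel) q \<partial>lborel)"
    using pq by (simp add: nn_integral_multc epowr_mult epowr_epowr)
  also have "epowr \<dots> (1 / q) \<le> (\<integral>\<^sup>+t. epowr (\<integral>\<^sup>+x. epowr (F x t * epowr (v x) (1 / q)) q \<partial>lborel) (1 / q) \<partial>lborel)"
  proof (rule lborel_pair.nn_integral_Minkowski[OF pq(1)])
    show "(\<lambda>(x, t). F x t * epowr (v x) (1 / q)) \<in> borel_measurable (lborel \<Otimes>\<^sub>M lborel)"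
      unfolding F_def by measurable
  qed
  also have "\<dots> = (\<integral>\<^sup>+t. ennreal (k t) * weighted_norm q v (\<lambda>x. f (x / t)) \<partial>lborel)"
    using pq k0 by (intro nn_integral_cong)
      (simp add: F_def epowr_mult epowr_epowr nn_integral_cmult weighted_norm_def nn_integral_completion
        mult.assoc powr_powr epowr_ennreal)
  also have "\<dots> \<le> (\<integral>\<^sup>+t. ennreal (norm (\<phi> t) / \<bar>t\<bar> powr (2 * \<alpha> + 2 - 1 / q)) * K t * weighted_norm p w f \<partial>lborel)"
  proof (rule nn_integral_mono_AE, use AE_lborel_singleton[of 0] in eventually_elim)
    fix t :: real assume t: "t \<noteq> 0"
    have "ennreal (k t) * weighted_norm q v (\<lambda>x. f (x / t))
      \<le> ennreal (k t) * (ennreal (\<bar>t\<bar> powr (1 / q)) * K t * weighted_norm p w f)"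
      using weighted_norm_dilation_le[OF pq t _ _ _ w, of f v]
      by (intro mult_left_mono) (auto simp: K_def nn_integral_completion)
    also have "\<dots> = ennreal (k t * \<bar>t\<bar> powr (1 / q)) * K t * weighted_norm p w f"
      by (simp add: ennreal_mult k0 mult_ac)
    \<comment> \<open>The Jacobian accounts for the exponent $2\alpha + 2 - 1/q$ in $D_{\sup}$.\<close>
    also have "k t * \<bar>t\<bar> powr (1 / q) = norm (\<phi> t) / \<bar>t\<bar> powr (2 * \<alpha> + 2 - 1 / q)"
      using t by (simp add: k_def powr_diff)
    finally show "ennreal (k t) * weighted_norm q v (\<lambda>x. f (x / t))
      \<le> ennreal (norm (\<phi> t) / \<bar>t\<bar> powr (2 * \<alpha> + 2 - 1 / q)) * K t * weighted_norm p w f" .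
  qed
  also have "\<dots> = D_sup \<alpha> \<phi> p w q v * weighted_norm p w f"
    by (subst nn_integral_multc) (auto simp: D_sup_def K_def nn_integral_completion)
  finally show ?thesis
    by (simp add: F_eq)
qed

lemma ennreal_norm_integral_le:
  fixes f :: "'a \<Rightarrow> 'b :: {banach, second_countable_topology}"
  shows "ennreal (norm (\<integral>x. f x \<partial>M)) \<le> (\<integral>\<^sup>+x. ennreal (norm (f x)) \<partial>M)"
  by (cases "integrable M f") (auto intro: integral_norm_bound_ennreal simp: not_integrable_integral_eq)

lemma dunkl_hausdorff_bound_Borel:
  fixes f \<phi> :: "real \<Rightarrow> complex"
  assumes pq: "1 < q" "q < p"
    and [measurable]: "f \<in> borel_measurable borel" "\<phi> \<in> borel_measurable borel"
      "v \<in> borel_measurable borel" "w \<in> borel_measurable borel"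
    and v: "weight_fun v" and w: "weight_fun w"
    and D: "D_sup \<alpha> \<phi> p w q v < \<infinity>" and f: "weighted_norm p w f < \<infinity>"
  shows "AE x in lebesgue. integrable lebesgue (dunkl_integrand \<alpha> \<phi> f x)"
    and "dunkl_hausdorff \<alpha> \<phi> f \<in> borel_measurable lebesgue"
    and "weighted_norm q v (dunkl_hausdorff \<alpha> \<phi> f) \<le> D_sup \<alpha> \<phi> p w q v * weighted_norm p w f"
proof -
  have int_meas [measurable]: "(\<lambda>(x, t). dunkl_integrand \<alpha> \<phi> f x t) \<in> borel_measurable (lborel \<Otimes>\<^sub>M lborel)"
    unfolding dunkl_integrand_def by measurable
  have int_meas' [measurable]: "dunkl_integrand \<alpha> \<phi> f x \<in> borel_measurable borel" for x
    unfolding dunkl_integrand_def by measurable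
  define G where "G x = (\<integral>\<^sup>+t. ennreal (norm (dunkl_integrand \<alpha> \<phi> f x t)) \<partial>lborel)" for x
  have G_meas [measurable]: "G \<in> borel_measurable borel"
    unfolding G_def by measurable
  have H_eq: "dunkl_hausdorff \<alpha> \<phi> f x = (\<integral>t. dunkl_integrand \<alpha> \<phi> f x t \<partial>lborel)" for x
    unfolding dunkl_hausdorff_def by (rule integral_completion) simp
  have G: "epowr (\<integral>\<^sup>+x. epowr (G x) q * v x \<partial>lborel) (1 / q) \<le> D_sup \<alpha> \<phi> p w q v * weighted_norm p w f"
    unfolding G_def using pq w by (intro weighted_norm_absolute_dunkl_hausdorff_le) auto
  show "AE x in lebesgue. integrable lebesgue (dunkl_integrand \<alpha> \<phi> f x)"
  proof -
    have "epowr (\<integral>\<^sup>+x. epowr (G x) q * v x \<partial>lborel) (1 / q) < \<infinity>"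
      using G by (rule le_less_trans) (use D f in \<open>simp add: ennreal_mult_less_top\<close>)
    then have "AE x in lborel. epowr (G x) q * v x \<noteq> \<infinity>"
      by (intro nn_integral_noteq_infinite) (auto simp: less_top)
    moreover have "AE x in lborel. 0 < v x \<and> v x < \<infinity>"
      using v by (simp add: weight_fun_def AE_completion_iff)
    ultimately have "AE x in lborel. integrable lborel (dunkl_integrand \<alpha> \<phi> f x)"
    proof eventually_elim
      case (elim x)
      then have "G x < \<infinity>"
        by (auto simp: ennreal_mult_eq_top_iff less_top)
      then show ?case
        unfolding G_def by (intro integrableI_bounded) auto
    qed
    then show ?thesis
      by (intro AE_completion) (simp add: integrable_completion)
  qed
  show "dunkl_hausdorff \<alpha> \<phi> f \<in> borel_measurable lebesgue"
    unfolding H_eq[abs_def] by (intro measurable_completion) measurable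
  have "weighted_norm q v (dunkl_hausdorff \<alpha> \<phi> f) \<le> epowr (\<integral>\<^sup>+x. epowr (G x) q * v x \<partial>lborel) (1 / q)"
    unfolding weighted_norm_def nn_integral_completion
  proof (intro epowr_mono nn_integral_mono mult_right_mono)
    fix x
    have "ennreal (norm (dunkl_hausdorff \<alpha> \<phi> f x)) \<le> G x"
      unfolding H_eq G_def by (rule ennreal_norm_integral_le)
    then show "ennreal (norm (dunkl_hausdorff \<alpha> \<phi> f x) powr q) \<le> epowr (G x) q"
      using pq by (subst epowr_ennreal[symmetric]) (auto intro: epowr_mono)
  qed (use pq in auto)
  also note G
  finally show "weighted_norm q v (dunkl_hausdorff \<alpha> \<phi> f) \<le> D_sup \<alpha> \<phi> p w q v * weighted_norm p w f" .
qed

theorem dunkl_hausdorff_bound: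
  fixes f \<phi> :: "real \<Rightarrow> complex"
  assumes pq: "1 < q" "q < p"
    and v: "weight_fun v" and w: "weight_fun w"
    and \<phi>: "\<phi> \<in> borel_measurable lebesgue"
    and D: "D_sup \<alpha> \<phi> p w q v < \<infinity>" and f: "f \<in> weighted_Lp p w"
  shows "AE x in lebesgue. integrable lebesgue (dunkl_integrand \<alpha> \<phi> f x)" (is ?integrable)
    and "dunkl_hausdorff \<alpha> \<phi> f \<in> borel_measurable lebesgue" (is ?measurable)
    and "weighted_norm q v (dunkl_hausdorff \<alpha> \<phi> f) \<le> D_sup \<alpha> \<phi> p w q v * weighted_norm p w f" (is ?bound)
proof -
  obtain \<phi>' where \<phi>' [measurable]: "\<phi>' \<in> borel_measurable borel" and \<phi>_eq: "AE t in lebesgue. \<phi> t = \<phi>' t"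
    using lebesgue_complex_Borel_representative[OF \<phi>] .
  obtain g where g [measurable]: "g \<in> borel_measurable borel" and f_eq: "AE y in lebesgue. f y = g y"
    using f lebesgue_complex_Borel_representative[of f] by (auto simp: weighted_Lp_def)
  obtain v' where v' [measurable]: "v' \<in> borel_measurable borel" "weight_fun v'"
    and v_eq: "AE x in lebesgue. v x = v' x"
    using weight_fun_Borel_representative[OF v] .
  obtain w' where w' [measurable]: "w' \<in> borel_measurable borel" "weight_fun w'"
    and w_eq: "AE x in lebesgue. w x = w' x"
    using weight_fun_Borel_representative[OF w] .
  have D_eq: "D_sup \<alpha> \<phi> p w q v = D_sup \<alpha> \<phi>' p w' q v'"
    using \<phi>_eq v_eq w_eq by (rule D_sup_cong_AE)
  have f_norm: "weighted_norm p w f = weighted_norm p w' g"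
    using w_eq f_eq by (rule weighted_norm_cong_AE)
  have fin: "D_sup \<alpha> \<phi>' p w' q v' < \<infinity>" "weighted_norm p w' g < \<infinity>"
    using D f by (auto simp: D_eq weighted_Lp_def f_norm)
  note Borel = dunkl_hausdorff_bound_Borel[OF pq g \<phi>' v'(1) w'(1) v'(2) w'(2) fin]
  have same: "(integrable lebesgue (dunkl_integrand \<alpha> \<phi> f x) \<longleftrightarrow> integrable lebesgue (dunkl_integrand \<alpha> \<phi>' g x))
      \<and> dunkl_hausdorff \<alpha> \<phi> f x = dunkl_hausdorff \<alpha> \<phi>' g x" if "x \<noteq> 0" for x
  proof -
    have eq: "AE t in lebesgue. dunkl_integrand \<alpha> \<phi> f x t = dunkl_integrand \<alpha> \<phi>' g x t"
      using \<phi>_eq f_eq that by (rule dunkl_integrand_cong_AE)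
    have "dunkl_integrand \<alpha> \<phi>' g x \<in> borel_measurable borel"
      unfolding dunkl_integrand_def by measurable
    then have meas: "dunkl_integrand \<alpha> \<phi>' g x \<in> borel_measurable lebesgue"
      by (intro measurable_completion) simp
    moreover have "dunkl_integrand \<alpha> \<phi> f x \<in> borel_measurable lebesgue"
      using meas by (rule borel_measurable_AE) (use eq in eventually_elim, simp)
    ultimately show ?thesis
      unfolding dunkl_hausdorff_def using eq by (metis integral_cong_AE integrable_cong_AE)
  qed
  have H_eq: "AE x in lebesgue. dunkl_hausdorff \<alpha> \<phi> f x = dunkl_hausdorff \<alpha> \<phi>' g x"
    using AE_lebesgue_neq[of 0] by eventually_elim (simp add: same)
  show ?integrable
    using AE_lebesgue_neq[of 0] Borel(1) by eventually_elim (simp add: same)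
  show ?measurable
    using Borel(2) by (rule borel_measurable_AE) (use H_eq in eventually_elim, simp)
  show ?bound
    using Borel(3) by (simp add: D_eq f_norm weighted_norm_cong_AE[OF v_eq H_eq])
qed

theorem theorem4p2:
  fixes p q \<alpha> :: real
    and v w :: "real \<Rightarrow> ennreal"
    and \<phi> :: "real \<Rightarrow> complex"
  assumes "1 < q" and "q < p"
    and "weight_fun v" and "weight_fun w"
    and "integrable lebesgue \<phi>"
    and "D_sup \<alpha> \<phi> p w q v < \<infinity>"
  shows "dunkl_hausdorff_bounded \<alpha> \<phi> p w q v \<and>
    (\<forall>f\<in>weighted_Lp p w.
       weighted_norm q v (dunkl_hausdorff \<alpha> \<phi> f) \<le> D_sup \<alpha> \<phi> p w q v * weighted_norm p w f)"
proof -
  note H = dunkl_hausdorff_bound[OF assms(1-4) borel_measurable_integrable[OF assms(5)] assms(6)]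
  have "weighted_norm q v (dunkl_hausdorff \<alpha> \<phi> f) < \<infinity>" if "f \<in> weighted_Lp p w" for f
    using H(3)[OF that] assms(6) that
    by (auto simp: weighted_Lp_def ennreal_mult_less_top intro: le_less_trans)
  then show ?thesis
    unfolding dunkl_hausdorff_bounded_def using H assms(6) by (auto simp: weighted_Lp_def)
qed

end
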